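(* Let $n \geqslant 2$ and let $X_n$ be a real normed linear space with $\dim X_n = n$. Then $\zeta_{X_n} \leqslant 2\frac{n-1}{n}$. Moreover, if $X_n=\ell_1^n$ or $X_n=\ell_\infty^n$, then equality holds: $\zeta_{X_n} = 2\frac{n-1}{n}$.
   Context: For a real normed space $X$, $B_R(c)$ denotes the closed ball with center $c$ and radius $R>0$, $o$ is the origin, $\operatorname{co} D$ is the convex hull of $D$, and $\rho(x,A)=\inf_{a\in A}\|x-a\|$. The deviation of $A$ from $B$ is $h^{+}(A,B)=\sup_{x\in A}\rho(x,B)$. The CHD-constant (convex hull deviation constant) of $X$ is $\zeta_X=\sup h^{+}(\operatorname{co} D, D)$, where the supremum is over all nonempty sets $D\subset B_1(o)$. $\ell_p^n$ denotes $\mathbb{R}^n$ with the $p$-norm. *)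

theory Defs
  imports "HOL-Analysis.Analysis"
begin

section \<open>Deviation and the CHD-constant\<close>

text \<open>The suprema below are real-valued. They are suprema of nonempty sets bounded above for all
  arguments occurring in \<open>CHD_const\<close>; see \<open>bdd_above_deviation\<close>,
  \<open>bdd_above_CHD_const\<close> and \<open>nonempty_CHD_const\<close>.\<close>

definition deviation :: "'a::metric_space set \<Rightarrow> 'a set \<Rightarrow> real" where
  "deviation A B = (SUP x\<in>A. infdist x B)"

definition CHD_const :: "'a::real_normed_vector itself \<Rightarrow> real" where
  "CHD_const _ =
     (SUP D \<in> {D :: 'a set. D \<noteq> {} \<and> D \<subseteq> cball 0 1}. deviation (convex hull D) D)"

lemma infdist_convex_hull_le:
  fixes D :: "'a::real_normed_vector set"
  assumes "D \<noteq> {}" "D \<subseteq> cball 0 1" "x \<in> convex hull D"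
  shows "infdist x D \<le> 2"
proof -
  obtain d where d: "d \<in> D" using assms(1) by blast
  have "convex hull D \<subseteq> cball 0 1"
    using assms(2) by (intro hull_minimal) auto
  then have "norm x \<le> 1" "norm d \<le> 1" using assms d by auto
  then have "dist x d \<le> 2"
    using norm_triangle_ineq4[of x d] by (simp add: dist_norm)
  then show ?thesis using infdist_le[OF d, of x] by linarith
qed

lemma bdd_above_deviation:
  fixes D :: "'a::real_normed_vector set"
  assumes "D \<noteq> {}" "D \<subseteq> cball 0 1"
  shows "bdd_above ((\<lambda>x. infdist x D) ` (convex hull D))"
  using infdist_convex_hull_le[OF assms] by (intro bdd_aboveI2)

lemma deviation_convex_hull_le:
  fixes D :: "'a::real_normed_vector set"
  assumes "D \<noteq> {}" "D \<subseteq> cball 0 1"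
  shows "deviation (convex hull D) D \<le> 2"
  unfolding deviation_def
  using infdist_convex_hull_le[OF assms] assms(1) by (intro cSUP_least) auto

lemma bdd_above_CHD_const:
  "bdd_above ((\<lambda>D :: 'a::real_normed_vector set. deviation (convex hull D) D) `
     {D. D \<noteq> {} \<and> D \<subseteq> cball 0 1})"
  by (intro bdd_aboveI2[where M = 2] deviation_convex_hull_le) auto

lemma nonempty_CHD_const: "{D :: 'a::real_normed_vector set. D \<noteq> {} \<and> D \<subseteq> cball 0 1} \<noteq> {}"
proof -
  have "{0} \<in> {D :: 'a set. D \<noteq> {} \<and> D \<subseteq> cball 0 1}" by simp
  then show ?thesis by blast
qed


section \<open>The spaces \<open>\<ell>\<^sub>1\<^sup>n\<close> and \<open>\<ell>\<^sub>\<infinity>\<^sup>n\<close>\<close>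

text \<open>The type \<^typ>\<open>real ^ 'n\<close> carries the Euclidean norm, so the other two norms live on copies of it.\<close>

typedef 'n ell1 = "UNIV :: (real ^ 'n) set" morphisms vec_of_ell1 ell1_of_vec ..

typedef 'n ellinf = "UNIV :: (real ^ 'n) set" morphisms vec_of_ellinf ellinf_of_vec ..

lemmas ell1_simps [simp] =
  ell1_of_vec_inverse[OF UNIV_I] vec_of_ell1_inverse ell1_of_vec_inject[OF UNIV_I UNIV_I]

lemmas ellinf_simps [simp] =
  ellinf_of_vec_inverse[OF UNIV_I] vec_of_ellinf_inverse ellinf_of_vec_inject[OF UNIV_I UNIV_I]

instantiation ell1 :: (finite) real_normed_vector
begin

definition zero_ell1 :: "'a ell1" where "0 = ell1_of_vec 0"
definition plus_ell1 :: "'a ell1 \<Rightarrow> 'a ell1 \<Rightarrow> 'a ell1"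
  where "x + y = ell1_of_vec (vec_of_ell1 x + vec_of_ell1 y)"
definition minus_ell1 :: "'a ell1 \<Rightarrow> 'a ell1 \<Rightarrow> 'a ell1"
  where "x - y = ell1_of_vec (vec_of_ell1 x - vec_of_ell1 y)"
definition uminus_ell1 :: "'a ell1 \<Rightarrow> 'a ell1" where "- x = ell1_of_vec (- vec_of_ell1 x)"
definition scaleR_ell1 :: "real \<Rightarrow> 'a ell1 \<Rightarrow> 'a ell1"
  where "r *\<^sub>R x = ell1_of_vec (r *\<^sub>R vec_of_ell1 x)"
definition norm_ell1 :: "'a ell1 \<Rightarrow> real" where "norm_ell1 x = (\<Sum>i\<in>UNIV. \<bar>vec_of_ell1 x $ i\<bar>)"
definition dist_ell1 :: "'a ell1 \<Rightarrow> 'a ell1 \<Rightarrow> real" where "dist_ell1 x y = norm (x - y)"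
definition sgn_ell1 :: "'a ell1 \<Rightarrow> 'a ell1" where "sgn_ell1 x = inverse (norm x) *\<^sub>R x"
definition uniformity_ell1 :: "('a ell1 \<times> 'a ell1) filter"
  where "uniformity_ell1 = (INF e\<in>{0<..}. principal {(x, y). dist x y < e})"
definition open_ell1 :: "'a ell1 set \<Rightarrow> bool"
  where "open_ell1 U = (\<forall>x\<in>U. \<forall>\<^sub>F (x', y) in uniformity. x' = x \<longrightarrow> y \<in> U)"

instance
proof
  fix x y :: "'a ell1" and a :: real
  show "norm x = 0 \<longleftrightarrow> x = 0"
    by (subst vec_of_ell1_inject[symmetric])
      (simp add: norm_ell1_def zero_ell1_def sum_nonneg_eq_0_iff vec_eq_iff)
  show "norm (x + y) \<le> norm x + norm y"
    unfolding norm_ell1_def plus_ell1_def sum.distrib[symmetric] by (intro sum_mono) simp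
  show "norm (a *\<^sub>R x) = \<bar>a\<bar> * norm x"
    by (simp add: norm_ell1_def scaleR_ell1_def abs_mult sum_distrib_left)
qed (simp_all add: zero_ell1_def plus_ell1_def minus_ell1_def uminus_ell1_def scaleR_ell1_def
    dist_ell1_def sgn_ell1_def uniformity_ell1_def open_ell1_def algebra_simps)

end

instantiation ellinf :: (finite) real_normed_vector
begin

definition zero_ellinf :: "'a ellinf" where "0 = ellinf_of_vec 0"
definition plus_ellinf :: "'a ellinf \<Rightarrow> 'a ellinf \<Rightarrow> 'a ellinf"
  where "x + y = ellinf_of_vec (vec_of_ellinf x + vec_of_ellinf y)"
definition minus_ellinf :: "'a ellinf \<Rightarrow> 'a ellinf \<Rightarrow> 'a ellinf"
  where "x - y = ellinf_of_vec (vec_of_ellinf x - vec_of_ellinf y)"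
definition uminus_ellinf :: "'a ellinf \<Rightarrow> 'a ellinf" where "- x = ellinf_of_vec (- vec_of_ellinf x)"
definition scaleR_ellinf :: "real \<Rightarrow> 'a ellinf \<Rightarrow> 'a ellinf"
  where "r *\<^sub>R x = ellinf_of_vec (r *\<^sub>R vec_of_ellinf x)"
definition norm_ellinf :: "'a ellinf \<Rightarrow> real" where "norm_ellinf x = (MAX i. \<bar>vec_of_ellinf x $ i\<bar>)"
definition dist_ellinf :: "'a ellinf \<Rightarrow> 'a ellinf \<Rightarrow> real" where "dist_ellinf x y = norm (x - y)"
definition sgn_ellinf :: "'a ellinf \<Rightarrow> 'a ellinf" where "sgn_ellinf x = inverse (norm x) *\<^sub>R x"
definition uniformity_ellinf :: "('a ellinf \<times> 'a ellinf) filter"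
  where "uniformity_ellinf = (INF e\<in>{0<..}. principal {(x, y). dist x y < e})"
definition open_ellinf :: "'a ellinf set \<Rightarrow> bool"
  where "open_ellinf U = (\<forall>x\<in>U. \<forall>\<^sub>F (x', y) in uniformity. x' = x \<longrightarrow> y \<in> U)"

instance
proof
  fix x y :: "'a ellinf" and a :: real
  have ge: "\<bar>vec_of_ellinf z $ i\<bar> \<le> norm z" for z :: "'a ellinf" and i
    unfolding norm_ellinf_def by (intro Max_ge) auto
  have ge0: "0 \<le> norm z" for z :: "'a ellinf"
    using ge[of z undefined] by linarith
  show "norm x = 0 \<longleftrightarrow> x = 0"
  proof
    assume "norm x = 0"
    then have "vec_of_ellinf x = 0" using ge[of x] by (simp add: vec_eq_iff)
    then show "x = 0" by (metis vec_of_ellinf_inverse zero_ellinf_def)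
  qed (simp add: norm_ellinf_def zero_ellinf_def)
  show "norm (x + y) \<le> norm x + norm y"
  proof -
    have "\<bar>vec_of_ellinf (x + y) $ i\<bar> \<le> norm x + norm y" for i
      using ge[of x i] ge[of y i] by (simp add: plus_ellinf_def)
    then show ?thesis unfolding norm_ellinf_def[of "x + y"] by (intro Max.boundedI) auto
  qed
  show "norm (a *\<^sub>R x) = \<bar>a\<bar> * norm x"
  proof -
    have "norm (a *\<^sub>R x) = (MAX i. \<bar>a\<bar> * \<bar>vec_of_ellinf x $ i\<bar>)"
      by (simp add: norm_ellinf_def scaleR_ellinf_def abs_mult)
    also have "\<dots> = \<bar>a\<bar> * norm x"
      unfolding norm_ellinf_def
      by (subst mono_Max_commute[where f = "\<lambda>t. \<bar>a\<bar> * t"])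
        (auto simp: mono_def mult_left_mono image_image)
    finally show ?thesis .
  qed
qed (simp_all add: zero_ellinf_def plus_ellinf_def minus_ellinf_def uminus_ellinf_def
    scaleR_ellinf_def dist_ellinf_def sgn_ellinf_def uniformity_ellinf_def open_ellinf_def
    algebra_simps)

end

lemma dim_ell1: "dim (UNIV :: 'n::finite ell1 set) = CARD('n)"
proof -
  have lin: "linear (ell1_of_vec :: real ^ 'n \<Rightarrow> 'n ell1)"
    by (rule linearI) (simp_all add: plus_ell1_def scaleR_ell1_def)
  obtain B :: "(real ^ 'n) set" where B: "independent B" "span B = UNIV" "card B = CARD('n)"
    using basis_exists[of "UNIV :: (real ^ 'n) set"] by (auto simp: top_unique)
  have inj: "inj (ell1_of_vec :: real ^ 'n \<Rightarrow> 'n ell1)" by (simp add: inj_def)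
  have surj: "range (ell1_of_vec :: real ^ 'n \<Rightarrow> 'n ell1) = UNIV"
    by (metis surjI vec_of_ell1_inverse)
  have "span (ell1_of_vec ` B) = UNIV"
    using linear_span_image[OF lin, of B] B(2) surj by simp
  moreover have "independent (ell1_of_vec ` B)"
    using linear_independent_injective_image[OF lin B(1)] inj by (simp add: inj_on_def)
  moreover have "card (ell1_of_vec ` B) = CARD('n)"
    using B(3) by (simp add: card_image inj_on_def)
  ultimately show ?thesis by (intro dim_unique[of "ell1_of_vec ` B"]) auto
qed

lemma dim_ellinf: "dim (UNIV :: 'n::finite ellinf set) = CARD('n)"
proof -
  have lin: "linear (ellinf_of_vec :: real ^ 'n \<Rightarrow> 'n ellinf)"
    by (rule linearI) (simp_all add: plus_ellinf_def scaleR_ellinf_def)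
  obtain B :: "(real ^ 'n) set" where B: "independent B" "span B = UNIV" "card B = CARD('n)"
    using basis_exists[of "UNIV :: (real ^ 'n) set"] by (auto simp: top_unique)
  have inj: "inj (ellinf_of_vec :: real ^ 'n \<Rightarrow> 'n ellinf)" by (simp add: inj_def)
  have surj: "range (ellinf_of_vec :: real ^ 'n \<Rightarrow> 'n ellinf) = UNIV"
    by (metis surjI vec_of_ellinf_inverse)
  have "span (ellinf_of_vec ` B) = UNIV"
    using linear_span_image[OF lin, of B] B(2) surj by simp
  moreover have "independent (ellinf_of_vec ` B)"
    using linear_independent_injective_image[OF lin B(1)] inj by (simp add: inj_on_def)
  moreover have "card (ellinf_of_vec ` B) = CARD('n)"
    using B(3) by (simp add: card_image inj_on_def)
  ultimately show ?thesis by (intro dim_unique[of "ellinf_of_vec ` B"]) auto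
qed

end

theory Submission
  imports Defs
begin

text \<open>
  Upper bound. If a point \<open>y\<close> is a convex combination of at most \<open>n\<close> points of the unit ball, some
  weight is at least \<open>1 / n\<close>; all the points lie within distance 2 of the one carrying that weight,
  so this point is within \<open>2 * (1 - 1 / n)\<close> of \<open>y\<close> (\<open>close_point_of_convex_hull_card_le\<close>).
  Caratheodory's theorem alone would yield \<open>n + 1\<close> points and hence only the bound
  \<open>2 * n / (n + 1)\<close>. The missing point is gained by not insisting on the given \<open>x\<close>: a simplex is
  bounded, so the ray from the origin through \<open>x\<close>, continued beyond \<open>x\<close>, leaves it through a facet,
  at a point \<open>t *\<^sub>R x\<close> with \<open>t \<ge> 1\<close> that needs only \<open>n\<close> vertices
  (\<open>ray_meets_convex_hull_card_le\<close>). A vertex \<open>d\<close> close to \<open>t *\<^sub>R x\<close> is also close to \<open>x\<close>: the ball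
  about \<open>d\<close> with radius \<open>2 * (n - 1) / n \<ge> 1\<close> contains the origin and \<open>t *\<^sub>R x\<close>, hence \<open>x\<close>, which
  lies between them. For \<open>x = 0\<close>, where there is no ray, every point of the unit ball is within 1.

  Lower bound. The estimate for \<open>n\<close> points becomes an equality for the centroid of points at mutual
  distance 2 when the triangle inequality, applied to the sum of their differences, is an equality.
  In \<open>\<ell>\<^sub>1\<^sup>n\<close> the unit vectors \<open>e\<^sub>i\<close> have this property, in \<open>\<ell>\<^sub>\<infinity>\<^sup>n\<close> the points
  \<open>(1, \<dots>, 1) - 2 e\<^sub>i\<close>.
\<close>

section \<open>The upper bound\<close>

lemma close_point_of_convex_hull_card_le:
  fixes T :: "'a::real_normed_vector set"
  assumes "finite T" "T \<subseteq> cball 0 1" "card T \<le> n" "y \<in> convex hull T"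
  shows "\<exists>d\<in>T. dist y d \<le> 2 * ((real n - 1) / real n)"
proof -
  obtain u where u: "\<forall>v\<in>T. 0 \<le> u v" "sum u T = 1" "(\<Sum>v\<in>T. u v *\<^sub>R v) = y"
    using assms(4) by (auto simp: convex_hull_finite[OF assms(1)])
  have "T \<noteq> {}" using u(2) by auto
  then have "card T > 0" using assms(1) by (simp add: card_gt_0_iff)
  then have n: "real n > 0" using assms(3) by simp
  have "\<exists>d\<in>T. u d \<ge> 1 / real n"
  proof (rule ccontr)
    assume "\<not> ?thesis"
    then have "sum u T < (\<Sum>v\<in>T. 1 / real n)"
      using assms(1) \<open>T \<noteq> {}\<close> by (intro sum_strict_mono) auto
    also have "\<dots> \<le> 1" using n assms(3) by simp
    finally show False using u(2) by simp
  qed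
  then obtain d where d: "d \<in> T" "u d \<ge> 1 / real n" by blast
  have "y - d = (\<Sum>v\<in>T. u v *\<^sub>R v) - (\<Sum>v\<in>T. u v) *\<^sub>R d" using u by simp
  also have "\<dots> = (\<Sum>v\<in>T. u v *\<^sub>R (v - d))"
    by (simp add: scaleR_sum_left sum_subtractf scaleR_diff_right)
  also have "\<dots> = (\<Sum>v\<in>T-{d}. u v *\<^sub>R (v - d))"
    using assms(1) d(1) by (simp add: sum.remove)
  finally have "dist y d \<le> (\<Sum>v\<in>T-{d}. norm (u v *\<^sub>R (v - d)))"
    unfolding dist_norm by (metis norm_sum)
  also have "\<dots> \<le> (\<Sum>v\<in>T-{d}. u v * 2)"
  proof (intro sum_mono)
    fix v assume v: "v \<in> T - {d}"
    then have "norm v \<le> 1" "norm d \<le> 1" using assms(2) d(1) by auto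
    then have "norm (v - d) \<le> 2" using norm_triangle_ineq4[of v d] by linarith
    then show "norm (u v *\<^sub>R (v - d)) \<le> u v * 2"
      using u(1) v by (simp add: mult_left_mono)
  qed
  also have "\<dots> = 2 * (1 - u d)"
    using u(2) assms(1) d(1) by (simp add: sum_distrib_right[symmetric] sum.remove[of T d u])
  also have "\<dots> \<le> 2 * ((real n - 1) / real n)"
    using d(2) n by (simp add: field_simps)
  finally show ?thesis using d(1) by blast
qed

text \<open>A direction in which the barycentric weights on \<open>S\<close> can be changed so that the represented
  point moves outwards along its ray or stays put. An affine dependence of \<open>S\<close> leaves the point
  fixed. An affinely independent \<open>S\<close> has the whole space
  as affine hull, and the weights of \<open>x\<close> minus the weights of the origin are such a direction.\<close>

lemma outward_weight_direction:
  fixes S :: "'a::real_normed_vector set"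
  assumes dim: "dim (UNIV :: 'a set) = n" "n > 0"
    and S: "finite S" "card S > n" and x: "x \<noteq> 0"
  obtains u c where "sum u S = 0" "\<exists>v\<in>S. u v \<noteq> 0" "c \<ge> 0" "(\<Sum>v\<in>S. u v *\<^sub>R v) = c *\<^sub>R x"
proof (cases "affine_dependent S")
  case True
  then show thesis
    using S(1) that[of _ 0] by (auto simp: affine_dependent_explicit_finite)
next
  case False
  obtain B :: "'a set" where B: "independent B" "span B = UNIV" "card B = n"
    using basis_exists[of "UNIV :: 'a set"] dim(1) by (auto simp: top_unique)
  have finB: "finite B" using B(3) dim(2) card_ge_0_finite by blast
  have "S \<noteq> {}" using S(2) by auto
  then obtain a where a: "a \<in> S" by blast
  define V where "V = (\<lambda>v. - a + v) ` (S - {a})"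
  have "independent V"
    using False affine_dependent_iff_dependent2[OF a] by (simp add: V_def)
  moreover have "card V = card S - 1"
    using S(1) a by (simp add: V_def card_image inj_on_def)
  then have cardV: "card V \<ge> n" using S(2) by linarith
  have "span V = UNIV"
  proof (rule ccontr)
    assume "span V \<noteq> UNIV"
    then obtain z where z: "z \<notin> span V" by blast
    have "independent (insert z V)" using z \<open>independent V\<close> by (simp add: independent_insert)
    then have "card (insert z V) \<le> card B"
      using independent_span_bound[OF finB] B(2) by blast
    moreover have "z \<notin> V" using z span_base by blast
    moreover have "finite V" using S(1) by (simp add: V_def)
    ultimately show False using cardV B(3) by simp
  qed
  then have "affine hull S = UNIV"
    using affine_hull_span2[OF a] by (simp add: V_def surj_plus)
  then have "0 \<in> affine hull S" "x \<in> affine hull S" by auto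
  then obtain p q where p: "sum p S = 1" "(\<Sum>v\<in>S. p v *\<^sub>R v) = 0"
    and q: "sum q S = 1" "(\<Sum>v\<in>S. q v *\<^sub>R v) = x"
    by (auto simp: affine_hull_finite[OF S(1)])
  show thesis
  proof (rule that[of "\<lambda>v. q v - p v" 1])
    show "(\<Sum>v\<in>S. (q v - p v) *\<^sub>R v) = 1 *\<^sub>R x"
      using p(2) q(2) by (simp add: scaleR_diff_left sum_subtractf)
    then show "\<exists>v\<in>S. q v - p v \<noteq> 0" using x by (force intro: ccontr)
  qed (use p q in \<open>auto simp: sum_subtractf\<close>)
qed

text \<open>One vertex is dropped by following the direction above until the first weight vanishes; a
  negative component, which makes this happen, exists because the components sum to zero.\<close>

lemma ray_meets_convex_hull_remove:
  fixes S :: "'a::real_normed_vector set"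
  assumes dim: "dim (UNIV :: 'a set) = n" "n > 0"
    and S: "finite S" "card S > n" and x: "x \<noteq> 0" "x \<in> convex hull S"
  obtains t a where "t \<ge> 1" "a \<in> S" "t *\<^sub>R x \<in> convex hull (S - {a})"
proof -
  obtain u c where u: "sum u S = 0" "\<exists>v\<in>S. u v \<noteq> 0" "c \<ge> 0" "(\<Sum>v\<in>S. u v *\<^sub>R v) = c *\<^sub>R x"
    by (rule outward_weight_direction[OF dim S x(1)])
  obtain l where l: "\<forall>v\<in>S. 0 \<le> l v" "sum l S = 1" "(\<Sum>v\<in>S. l v *\<^sub>R v) = x"
    using x(2) by (auto simp: convex_hull_finite[OF S(1)])
  define N where "N = {v\<in>S. u v < 0}"
  have finN: "finite N" using S(1) by (simp add: N_def)
  have "N \<noteq> {}"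
  proof
    assume "N = {}"
    then have "\<forall>v\<in>S. u v \<ge> 0" by (force simp: N_def)
    then show False using u(1,2) S(1) by (simp add: sum_nonneg_eq_0_iff)
  qed
  define s where "s = Min ((\<lambda>v. l v / - u v) ` N)"
  have "s \<in> (\<lambda>v. l v / - u v) ` N"
    unfolding s_def using finN \<open>N \<noteq> {}\<close> by (intro Min_in) auto
  then obtain a where a: "a \<in> S" "u a < 0" "s = l a / - u a" by (auto simp: N_def)
  have s: "s \<ge> 0" using a l(1) by (simp add: divide_nonneg_neg)
  have nonneg: "l v + s * u v \<ge> 0" if v: "v \<in> S" for v
  proof (cases "u v < 0")
    case True
    then have "s \<le> l v / - u v"
      unfolding s_def using finN v by (intro Min_le) (auto simp: N_def)
    then show ?thesis using True by (simp add: field_simps)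
  next
    case False
    then show ?thesis using l(1) v s by simp
  qed
  have zero: "l a + s * u a = 0" using a by simp
  have "(\<Sum>v\<in>S-{a}. l v + s * u v) = (\<Sum>v\<in>S. l v + s * u v)"
    using S(1) a(1) zero by (simp add: sum.remove)
  also have "\<dots> = 1" using l(2) u(1) by (simp add: sum.distrib sum_distrib_left[symmetric])
  finally have sum1: "(\<Sum>v\<in>S-{a}. l v + s * u v) = 1" .
  have "(\<Sum>v\<in>S-{a}. (l v + s * u v) *\<^sub>R v) = (\<Sum>v\<in>S. (l v + s * u v) *\<^sub>R v)"
    using S(1) a(1) zero by (simp add: sum.remove)
  also have "\<dots> = (\<Sum>v\<in>S. l v *\<^sub>R v) + s *\<^sub>R (\<Sum>v\<in>S. u v *\<^sub>R v)"
    by (simp add: scaleR_add_left sum.distrib scaleR_sum_right)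
  also have "\<dots> = (1 + s * c) *\<^sub>R x" using l(3) u(4) by (simp add: scaleR_add_left)
  finally have "(1 + s * c) *\<^sub>R x \<in> convex hull (S - {a})"
    using nonneg sum1 S(1)
    by (auto simp: convex_hull_finite intro!: exI[of _ "\<lambda>v. l v + s * u v"])
  then show thesis using that[of "1 + s * c" a] s u(3) a(1) by simp
qed

lemma ray_meets_convex_hull_card_le:
  fixes S :: "'a::real_normed_vector set"
  assumes dim: "dim (UNIV :: 'a set) = n" "n > 0"
    and S: "finite S" and x: "x \<noteq> 0" "x \<in> convex hull S"
  shows "\<exists>t\<ge>1. \<exists>T\<subseteq>S. card T \<le> n \<and> t *\<^sub>R x \<in> convex hull T"
  using S x
proof (induction "card S" arbitrary: S x rule: less_induct)
  case less
  show ?case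
  proof (cases "card S \<le> n")
    case True
    then show ?thesis using less.prems by (intro exI[of _ 1]) auto
  next
    case False
    then have "card S > n" by simp
    then obtain t a where ta: "t \<ge> 1" "a \<in> S" "t *\<^sub>R x \<in> convex hull (S - {a})"
      by (rule ray_meets_convex_hull_remove[OF dim less.prems(1) _ less.prems(2,3)])
    have "card (S - {a}) < card S" using ta(2) less.prems(1) by (intro psubset_card_mono) auto
    moreover have "finite (S - {a})" "t *\<^sub>R x \<noteq> 0" using less.prems(1,2) ta(1) by auto
    ultimately obtain t' T where T: "t' \<ge> 1" "T \<subseteq> S - {a}" "card T \<le> n"
      "t' *\<^sub>R t *\<^sub>R x \<in> convex hull T"
      using less.hyps[of "S - {a}" "t *\<^sub>R x"] ta(3) by metis
    have "1 * 1 \<le> t' * t" using T(1) ta(1) by (intro mult_mono) auto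
    then show ?thesis using T(2-4) by (intro exI[of _ "t' * t"] conjI exI[of _ T]) auto
  qed
qed

theorem CHD_const_le:
  assumes dim: "dim (UNIV :: 'a::real_normed_vector set) = n" and n: "n \<ge> 2"
  shows "CHD_const TYPE('a) \<le> 2 * ((real n - 1) / real n)"
proof -
  define R where "R = 2 * ((real n - 1) / real n)"
  have R: "R \<ge> 1" using n by (simp add: R_def field_simps)
  have "infdist x D \<le> R" if D: "D \<subseteq> cball 0 1" "x \<in> convex hull D" for D and x :: 'a
  proof -
    obtain S u where S: "finite S" "S \<subseteq> D"
      and u: "\<forall>v\<in>S. 0 \<le> u v" "sum u S = 1" "(\<Sum>v\<in>S. u v *\<^sub>R v) = x"
      using D(2) unfolding convex_hull_explicit by blast
    have xS: "x \<in> convex hull S"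
      using u unfolding convex_hull_finite[OF S(1)] by blast
    have "\<exists>d\<in>S. dist x d \<le> R"
    proof (cases "x = 0")
      case True
      have "S \<noteq> {}" using xS by auto
      then obtain d where "d \<in> S" by blast
      then show ?thesis using True R S(2) D(1) by (intro bexI[of _ d]) auto
    next
      case False
      obtain t T where t: "t \<ge> 1" "T \<subseteq> S" "card T \<le> n" "t *\<^sub>R x \<in> convex hull T"
        using ray_meets_convex_hull_card_le[OF dim _ S(1) False xS] n by auto
      obtain d where d: "d \<in> T" "dist (t *\<^sub>R x) d \<le> R"
        using close_point_of_convex_hull_card_le[of T n "t *\<^sub>R x"] t S D(1) finite_subset
        unfolding R_def by blast
      have "norm d \<le> R" using d(1) t(2) S(2) D(1) R by fastforce
      then have "0 \<in> cball d R" "t *\<^sub>R x \<in> cball d R"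
        using d(2) by (auto simp: dist_commute)
      then have "(1 - 1 / t) *\<^sub>R 0 + (1 / t) *\<^sub>R t *\<^sub>R x \<in> cball d R"
        using t(1) by (intro convexD[OF convex_cball]) auto
      then have "dist x d \<le> R" using t(1) by (simp add: dist_commute)
      then show ?thesis using d(1) t(2) by blast
    qed
    then obtain d where "d \<in> D" "dist x d \<le> R" using S(2) by blast
    then show ?thesis by (rule infdist_le2)
  qed
  then show ?thesis
    unfolding CHD_const_def deviation_def R_def[symmetric]
    by (intro cSUP_least nonempty_CHD_const) auto
qed


section \<open>The lower bound for \<open>\<ell>\<^sub>1\<^sup>n\<close> and \<open>\<ell>\<^sub>\<infinity>\<^sup>n\<close>\<close>

text \<open>Taking the centroid rather than an arbitrary point makes the distances to all \<open>f i\<close> equal in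
  the symmetric configurations below.\<close>

lemma CHD_const_ge_centroid:
  fixes f :: "'n::finite \<Rightarrow> 'a::real_normed_vector"
  assumes ball: "\<And>i. norm (f i) \<le> 1"
    and far: "\<And>i. r \<le> norm ((\<Sum>j\<in>UNIV. (1 / real CARD('n)) *\<^sub>R f j) - f i)"
  shows "r \<le> CHD_const TYPE('a)"
proof -
  define x where "x = (\<Sum>j\<in>UNIV. (1 / real CARD('n)) *\<^sub>R f j)"
  define D where "D = range f"
  have D: "D \<noteq> {}" "D \<subseteq> cball 0 1" using ball by (auto simp: D_def)
  have x: "x \<in> convex hull D"
    unfolding x_def by (intro convex_sum) (auto simp: D_def hull_inc)
  have "r \<le> infdist x D"
    using far D(1) by (auto simp: D_def x_def dist_norm infdist_def intro!: cINF_greatest)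
  also have "\<dots> \<le> deviation (convex hull D) D"
    unfolding deviation_def using bdd_above_deviation[OF D] x by (intro cSUP_upper)
  also have "\<dots> \<le> CHD_const TYPE('a)"
    unfolding CHD_const_def using D bdd_above_CHD_const by (intro cSUP_upper) auto
  finally show ?thesis .
qed

lemma linear_vec_of_ell1: "linear (vec_of_ell1 :: 'n::finite ell1 \<Rightarrow> real ^ 'n)"
  by (rule linearI) (simp_all add: plus_ell1_def scaleR_ell1_def)

lemma linear_vec_of_ellinf: "linear (vec_of_ellinf :: 'n::finite ellinf \<Rightarrow> real ^ 'n)"
  by (rule linearI) (simp_all add: plus_ellinf_def scaleR_ellinf_def)

lemma CHD_const_ell1_ge:
  "2 * ((real CARD('n) - 1) / real CARD('n)) \<le> CHD_const TYPE('n::finite ell1)"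
proof (rule CHD_const_ge_centroid)
  let ?n = "real CARD('n)"
  let ?e = "\<lambda>i::'n. ell1_of_vec (axis i 1)"
  show "norm (?e i) \<le> 1" for i
    by (simp add: norm_ell1_def axis_def if_distrib cong: if_cong)
  show "2 * ((?n - 1) / ?n) \<le> norm ((\<Sum>j\<in>UNIV. (1 / ?n) *\<^sub>R ?e j) - ?e i)" for i
  proof -
    let ?y = "vec_of_ell1 ((\<Sum>j\<in>UNIV. (1 / ?n) *\<^sub>R ?e j) - ?e i)"
    have y: "?y $ k = 1 / ?n - (if k = i then 1 else 0)" for k
      by (simp add: linear_diff[OF linear_vec_of_ell1] linear_sum[OF linear_vec_of_ell1]
          linear_scale[OF linear_vec_of_ell1] axis_def if_distrib cong: if_cong)
    have n: "?n \<ge> 1" by simp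
    have "(\<Sum>k\<in>UNIV. \<bar>?y $ k\<bar>) = \<bar>?y $ i\<bar> + (\<Sum>k\<in>UNIV-{i}. \<bar>?y $ k\<bar>)"
      by (simp add: sum.remove)
    also have "(\<Sum>k\<in>UNIV-{i}. \<bar>?y $ k\<bar>) = (\<Sum>k\<in>UNIV-{i}. 1 / ?n)"
      by (intro sum.cong) (auto simp: y)
    also have "\<dots> = (?n - 1) / ?n" by (simp add: card_Diff_singleton)
    also have "\<bar>?y $ i\<bar> = (?n - 1) / ?n" using n by (simp add: y field_simps)
    finally show ?thesis unfolding norm_ell1_def by simp
  qed
qed

lemma CHD_const_ellinf_ge:
  "2 * ((real CARD('n) - 1) / real CARD('n)) \<le> CHD_const TYPE('n::finite ellinf)"
proof (rule CHD_const_ge_centroid)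
  let ?n = "real CARD('n)"
  let ?f = "\<lambda>i::'n. ellinf_of_vec (\<chi> k. 1 - (if k = i then 2 else 0))"
  show "norm (?f i) \<le> 1" for i
    unfolding norm_ellinf_def by (intro Max.boundedI) auto
  show "2 * ((?n - 1) / ?n) \<le> norm ((\<Sum>j\<in>UNIV. (1 / ?n) *\<^sub>R ?f j) - ?f i)" for i
  proof -
    let ?y = "vec_of_ellinf ((\<Sum>j\<in>UNIV. (1 / ?n) *\<^sub>R ?f j) - ?f i)"
    \<comment> \<open>The difference attains its norm at the one coordinate in which \<open>?f i\<close> is negative.\<close>
    have "?y $ i = (\<Sum>j\<in>UNIV. (1 / ?n) * (1 - (if i = j then 2 else 0))) + 1"
      by (simp add: linear_diff[OF linear_vec_of_ellinf] linear_sum[OF linear_vec_of_ellinf]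
          linear_scale[OF linear_vec_of_ellinf])
    also have "\<dots> = (1 / ?n) * (?n - 2) + 1"
      unfolding sum_distrib_left[symmetric] by (simp add: sum_subtractf)
    also have "\<dots> = 2 * ((?n - 1) / ?n)" by (simp add: field_simps)
    finally have "2 * ((?n - 1) / ?n) \<le> \<bar>?y $ i\<bar>" by simp
    also have "\<dots> \<le> (MAX k. \<bar>?y $ k\<bar>)" by (intro Max_ge) auto
    finally show ?thesis unfolding norm_ellinf_def .
  qed
qed

(* dim is 0 on infinite-dimensional spaces, so the first premise forces dimension n *)
theorem theorem1:
  fixes n :: nat
  assumes "n \<ge> 2"
  shows "(dim (UNIV :: 'a::real_normed_vector set) = n \<longrightarrow>
            CHD_const TYPE('a) \<le> 2 * ((real n - 1) / real n)) \<and>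
         (CARD('n::finite) = n \<longrightarrow>
            CHD_const TYPE('n ell1) = 2 * ((real n - 1) / real n) \<and>
            CHD_const TYPE('n ellinf) = 2 * ((real n - 1) / real n))"
proof (intro conjI impI)
  show "CHD_const TYPE('a) \<le> 2 * ((real n - 1) / real n)" if "dim (UNIV :: 'a set) = n"
    using CHD_const_le[OF that assms] .
  show "CHD_const TYPE('n ell1) = 2 * ((real n - 1) / real n)" if "CARD('n) = n"
    using CHD_const_le[OF dim_ell1[where 'n = 'n]] CHD_const_ell1_ge[where 'n = 'n] that assms
    by (intro antisym) auto
  show "CHD_const TYPE('n ellinf) = 2 * ((real n - 1) / real n)" if "CARD('n) = n"
    using CHD_const_le[OF dim_ellinf[where 'n = 'n]] CHD_const_ellinf_ge[where 'n = 'n] that assms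
    by (intro antisym) auto
qed

end
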